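(* Let $(M^{1,2},\phi,\xi,\eta,g)$ be a three-dimensional Lorentzian Sasakian space-form with $\phi$-sectional curvature $H$ and let $\psi$ be a Sasakian quasi-Killing spinor (SqK-spinor) such that $(g,\psi)$ is a solution to the Einstein-Dirac (ED) system with eigenvalue $\lambda$ and cosmological constant $\Lambda$ of one of the following types: (i) $\psi$ of type $\left(-\frac12,\frac{H+1}{4}\right)$, $\lambda=\frac{H-5}{4}$, $\Lambda=1$; (ii) $H<3$, $\psi$ of type $\left(\frac{-1+\sqrt{3-H}}{2},\frac{2-\sqrt{3-H}}{2}\right)$, $\lambda=\sqrt{3-H}-\frac12$, $\Lambda=-\sqrt{3-H}+H-2$; (iii) $H<3$, $\psi$ of type $\left(\frac{-1-\sqrt{3-H}}{2},\frac{2+\sqrt{3-H}}{2}\right)$, $\lambda=-\sqrt{3-H}-\frac12$, $\Lambda=\sqrt{3-H}+H-2$, where in each case $\lambda\neq0$, $S-6\Lambda\neq0$ ($S$ the scalar curvature), and $\langle\psi,\psi\rangle=-\frac{S-6\Lambda}{\lambda}$. Then the ranges of $H$ (within the range of existence of the respective solution) for which the energy-momentum tensor $T=T^{spin}$ satisfies each energy condition are the following. Type (i): NEC iff $-1\le H$; WEC iff $1\le H$; DEC iff $3\le H$; SEC iff $-1\le H$. Type (ii): NEC iff $-1\le H$; WEC iff $-1\le H<3$; DEC iff $-1\le H<3$; SEC iff $2\le H<3$. Type (iii): NEC iff $-1\le H$; WEC iff $-1\le H<3$; DEC for no $H$; SEC iff $-1\le H<3$.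
   Context: Write $\mathrm{i}=\sqrt{-1}$. A Sasakian manifold is a contact metric manifold $(M,\phi,\xi,\eta,g)$ with Reeb field $\xi$, $\eta(\xi)=1$, satisfying $R(X,Y)\xi=\eta(Y)X-\eta(X)Y$; Lorentzian-Sasakian manifolds are obtained from Riemannian ones by replacing the metric $g'$ by $g'-2\eta\otimes\eta$, so $g(\xi,\xi)=-1$. The $\phi$-sectional curvature is $K(X,\phi X)$, $X\perp\xi$; a Sasakian space-form is a simply connected Sasakian manifold with constant $\phi$-sectional curvature $H$. In the three-dimensional Lorentzian case $\mathrm{Ric}=(H-1)g+(1+H)\eta\otimes\eta$. There is a global orthonormal frame (Sasakian frame) $e_1=\xi,e_2,e_3$, $g(e_i,e_j)=h_{ij}$, $h=\mathrm{diag}(-1,1,1)$, with $[e_1,e_2]=-\frac{H-3}{2}e_3$, $[e_1,e_3]=\frac{H-3}{2}e_2$, $[e_2,e_3]=-2e_1$; the dual coframe is $\omega^1=\eta,\omega^2,\omega^3$. Indices are raised with $h$. Spinor fields are $\mathbb{C}^2$-valued functions with respect to this frame, $e_j$ acts by Clifford multiplication via $\gamma_1=\sigma_1$, $\gamma_2=\mathrm{i}\sigma_2$, $\gamma_3=\mathrm{i}\sigma_3$ ($\sigma_j$ Pauli matrices), $\nabla_X\psi=X(\psi)+\omega^S(X)\psi$ with $\omega^S=-\frac{\mathrm{i}}{2}\sum_j\omega^j\gamma_j+\mathrm{i}\frac{H+1}{4}\omega^1\gamma_1$, and $\langle\psi_1,\psi_2\rangle=\psi_1^\dagger\gamma_1\psi_2$.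 An SqK-spinor of type $(a,b)$, $a,b\in\mathbb{R}$, satisfies $\nabla_X\psi=\mathrm{i}aX\cdot\psi+\mathrm{i}b\,\eta(X)\xi\cdot\psi$ for all $X$ (then $\langle\psi,\psi\rangle$ is constant). ED system: $D\psi=\lambda\psi$ with $D=\mathrm{i}\sum_j\gamma^j\nabla_{e_j}$, and $\mathrm{Ric}=T-\mathrm{tr}(T)g+2\Lambda g$ with $T(X,Y)=T^{spin}(X,Y)=\frac14\mathrm{Re}\langle\psi,\mathrm{i}(X\cdot\nabla_Y\psi+Y\cdot\nabla_X\psi)\rangle$. Energy conditions (dimension 3): NEC: $T(X,X)\ge0$ for every null $X$. WEC: $T(X,X)\ge0$ for every timelike $X$. DEC: $v=-{}^\sharp T(X,\cdot)$ is future-pointing causal for every future-pointing causal $X$ (time orientation given by $\xi$). SEC: $(T-\mathrm{tr}(T)g)(X,X)\ge0$ for every timelike $X$. *)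

theory Defs
  imports "HOL-Analysis.Analysis" "HOL-Library.Function_Algebras"
begin

subsection \<open>Smooth manifolds, tangent vectors and vector fields\<close>

text \<open>Intended for open sets \<open>S\<close>: all iterated partial derivatives up to order \<open>k\<close> exist
  and are continuous.\<close>

primrec Ck_on :: "nat \<Rightarrow> 'a::euclidean_space set \<Rightarrow> ('a \<Rightarrow> 'b::real_normed_vector) \<Rightarrow> bool" where
  "Ck_on 0 S f \<longleftrightarrow> continuous_on S f"
| "Ck_on (Suc k) S f \<longleftrightarrow>
     f differentiable_on S \<and> (\<forall>v. Ck_on k S (\<lambda>x. frechet_derivative f (at x) v))"

definition smooth_on :: "'a::euclidean_space set \<Rightarrow> ('a \<Rightarrow> 'b::real_normed_vector) \<Rightarrow> bool" where
  "smooth_on S f \<longleftrightarrow> (\<forall>k. Ck_on k S f)"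

text \<open>The underlying set of a manifold is a whole type. A chart is a pair of its domain and
  its coordinate map; only the values of the coordinate map on the domain matter.\<close>

type_synonym ('m, 'n) chart = "'m set \<times> ('m \<Rightarrow> real ^ 'n)"

definition smooth_atlas :: "('m::topological_space, 'n::finite) chart set \<Rightarrow> bool" where
  "smooth_atlas A \<longleftrightarrow>
     (\<forall>(U, x) \<in> A. open U \<and> open (x ` U) \<and> homeomorphism U (x ` U) x (inv_into U x)) \<and>
     (\<Union>(U, x) \<in> A. U) = UNIV \<and>
     (\<forall>(U, x) \<in> A. \<forall>(V, y) \<in> A. smooth_on (x ` (U \<inter> V)) (y \<circ> inv_into U x))"

definition smooth_fun :: "('m, 'n::finite) chart set \<Rightarrow> ('m \<Rightarrow> real) \<Rightarrow> bool" where
  "smooth_fun A f \<longleftrightarrow> (\<forall>(U, x) \<in> A. smooth_on (x ` U) (f \<circ> inv_into U x))"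

text \<open>Tangent vectors at \<open>p\<close> are the derivations at \<open>p\<close> of the algebra of smooth functions.
  They are set to \<open>0\<close> on functions that are not smooth, so that equal derivations are equal
  as HOL functions.\<close>

type_synonym 'm tangent = "('m \<Rightarrow> real) \<Rightarrow> real"
type_synonym 'm vfield = "'m \<Rightarrow> 'm tangent"

definition tangent_space :: "('m, 'n::finite) chart set \<Rightarrow> 'm \<Rightarrow> 'm tangent set" where
  "tangent_space A p = {v.
     (\<forall>f k a b. smooth_fun A f \<longrightarrow> smooth_fun A k \<longrightarrow>
        v (\<lambda>q. a * f q + b * k q) = a * v f + b * v k) \<and>
     (\<forall>f k. smooth_fun A f \<longrightarrow> smooth_fun A k \<longrightarrow>
        v (\<lambda>q. f q * k q) = v f * k p + f p * v k) \<and>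
     (\<forall>f. \<not> smooth_fun A f \<longrightarrow> v f = 0)}"

definition vector_field :: "('m, 'n::finite) chart set \<Rightarrow> 'm vfield \<Rightarrow> bool" where
  "vector_field A X \<longleftrightarrow> (\<forall>p. X p \<in> tangent_space A p) \<and>
     (\<forall>f. smooth_fun A f \<longrightarrow> smooth_fun A (\<lambda>p. X p f))"

text \<open>Sums, differences and the zero of tangent vectors and of vector fields are the pointwise
  ones of Function-Algebras.\<close>

definition tscale :: "real \<Rightarrow> 'm tangent \<Rightarrow> 'm tangent" where
  "tscale c v = (\<lambda>f. c * v f)"

definition vscale :: "('m \<Rightarrow> real) \<Rightarrow> 'm vfield \<Rightarrow> 'm vfield" where
  "vscale f X = (\<lambda>p. tscale (f p) (X p))"

definition lie_bracket :: "'m vfield \<Rightarrow> 'm vfield \<Rightarrow> 'm vfield" where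
  "lie_bracket X Y = (\<lambda>p f. X p (\<lambda>q. Y q f) - Y p (\<lambda>q. X q f))"

definition one_form :: "('m, 'n::finite) chart set \<Rightarrow> ('m \<Rightarrow> 'm tangent \<Rightarrow> real) \<Rightarrow> bool" where
  "one_form A \<alpha> \<longleftrightarrow>
     (\<forall>p. \<forall>v \<in> tangent_space A p. \<forall>w \<in> tangent_space A p. \<forall>a b.
        \<alpha> p (tscale a v + tscale b w) = a * \<alpha> p v + b * \<alpha> p w) \<and>
     (\<forall>X. vector_field A X \<longrightarrow> smooth_fun A (\<lambda>p. \<alpha> p (X p)))"

definition endomorphism_field ::
    "('m, 'n::finite) chart set \<Rightarrow> ('m \<Rightarrow> 'm tangent \<Rightarrow> 'm tangent) \<Rightarrow> bool" where
  "endomorphism_field A \<phi> \<longleftrightarrow>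
     (\<forall>p. \<forall>v \<in> tangent_space A p. \<phi> p v \<in> tangent_space A p) \<and>
     (\<forall>p. \<forall>v \<in> tangent_space A p. \<forall>w \<in> tangent_space A p. \<forall>a b.
        \<phi> p (tscale a v + tscale b w) = tscale a (\<phi> p v) + tscale b (\<phi> p w)) \<and>
     (\<forall>X. vector_field A X \<longrightarrow> vector_field A (\<lambda>p. \<phi> p (X p)))"

type_synonym 'm tensor2 = "'m \<Rightarrow> 'm tangent \<Rightarrow> 'm tangent \<Rightarrow> real"

definition symmetric_tensor :: "('m, 'n::finite) chart set \<Rightarrow> 'm tensor2 \<Rightarrow> bool" where
  "symmetric_tensor A g \<longleftrightarrow>
     (\<forall>p. \<forall>v \<in> tangent_space A p. \<forall>w \<in> tangent_space A p. g p v w = g p w v) \<and>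
     (\<forall>p. \<forall>u \<in> tangent_space A p. \<forall>v \<in> tangent_space A p. \<forall>w \<in> tangent_space A p. \<forall>a b.
        g p (tscale a u + tscale b v) w = a * g p u w + b * g p v w) \<and>
     (\<forall>X Y. vector_field A X \<longrightarrow> vector_field A Y \<longrightarrow> smooth_fun A (\<lambda>p. g p (X p) (Y p)))"

definition riemannian_metric :: "('m, 'n::finite) chart set \<Rightarrow> 'm tensor2 \<Rightarrow> bool" where
  "riemannian_metric A g \<longleftrightarrow> symmetric_tensor A g \<and>
     (\<forall>p. \<forall>v \<in> tangent_space A p. v \<noteq> 0 \<longrightarrow> g p v v > 0)"


subsection \<open>Connections and curvature\<close>

type_synonym 'm connection = "'m vfield \<Rightarrow> 'm vfield \<Rightarrow> 'm vfield"

definition affine_connection :: "('m, 'n::finite) chart set \<Rightarrow> 'm connection \<Rightarrow> bool" where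
  "affine_connection A nabla \<longleftrightarrow>
     (\<forall>X Y. vector_field A X \<longrightarrow> vector_field A Y \<longrightarrow> vector_field A (nabla X Y)) \<and>
     (\<forall>X Y Z. vector_field A X \<longrightarrow> vector_field A Y \<longrightarrow> vector_field A Z \<longrightarrow>
        nabla (X + Y) Z = nabla X Z + nabla Y Z \<and>
        nabla X (Y + Z) = nabla X Y + nabla X Z) \<and>
     (\<forall>X Y f. vector_field A X \<longrightarrow> vector_field A Y \<longrightarrow> smooth_fun A f \<longrightarrow>
        nabla (vscale f X) Y = vscale f (nabla X Y) \<and>
        nabla X (vscale f Y) = vscale (\<lambda>p. X p f) Y + vscale f (nabla X Y))"

definition levi_civita ::
    "('m, 'n::finite) chart set \<Rightarrow> 'm tensor2 \<Rightarrow> 'm connection \<Rightarrow> bool" where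
  "levi_civita A g nabla \<longleftrightarrow> affine_connection A nabla \<and>
     (\<forall>X Y. vector_field A X \<longrightarrow> vector_field A Y \<longrightarrow>
        nabla X Y - nabla Y X = lie_bracket X Y) \<and>
     (\<forall>X Y Z p. vector_field A X \<longrightarrow> vector_field A Y \<longrightarrow> vector_field A Z \<longrightarrow>
        X p (\<lambda>q. g q (Y q) (Z q)) = g p (nabla X Y p) (Z p) + g p (Y p) (nabla X Z p))"

definition curvature :: "'m connection \<Rightarrow> 'm vfield \<Rightarrow> 'm vfield \<Rightarrow> 'm vfield \<Rightarrow> 'm vfield" where
  "curvature nabla X Y Z =
     nabla X (nabla Y Z) - nabla Y (nabla X Z) - nabla (lie_bracket X Y) Z"

definition sectional_curvature ::
    "'m tensor2 \<Rightarrow> 'm connection \<Rightarrow> 'm vfield \<Rightarrow> 'm vfield \<Rightarrow> 'm \<Rightarrow> real" where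
  "sectional_curvature g nabla X Y p =
     g p (curvature nabla X Y Y p) (X p) /
     (g p (X p) (X p) * g p (Y p) (Y p) - (g p (X p) (Y p))\<^sup>2)"


subsection \<open>Sasakian structures\<close>

text \<open>The normalisation with the factor \<open>1/2\<close> is the one for which \<open>d\<eta>(X,Y) = g(X,\<phi> Y)\<close> is
  compatible with \<open>R(X,Y)\<xi> = \<eta>(Y)X - \<eta>(X)Y\<close> and with \<open>[e\<^sub>2,e\<^sub>3] = -2\<xi>\<close>.\<close>

definition ext_deriv ::
    "('m \<Rightarrow> 'm tangent \<Rightarrow> real) \<Rightarrow> 'm vfield \<Rightarrow> 'm vfield \<Rightarrow> 'm \<Rightarrow> real" where
  "ext_deriv \<eta> X Y p = 1/2 *
     (X p (\<lambda>q. \<eta> q (Y q)) - Y p (\<lambda>q. \<eta> q (X q)) - \<eta> p (lie_bracket X Y p))"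

text \<open>Contact form in dimension three, \<open>\<eta> \<and> d\<eta> \<noteq> 0\<close> at every point, with its Reeb field.\<close>

definition contact_form3 ::
    "('m, 3) chart set \<Rightarrow> ('m \<Rightarrow> 'm tangent \<Rightarrow> real) \<Rightarrow> 'm vfield \<Rightarrow> bool" where
  "contact_form3 A \<eta> \<xi> \<longleftrightarrow> one_form A \<eta> \<and> vector_field A \<xi> \<and>
     (\<forall>p. \<exists>X Y Z. vector_field A X \<and> vector_field A Y \<and> vector_field A Z \<and>
        \<eta> p (X p) * ext_deriv \<eta> Y Z p + \<eta> p (Y p) * ext_deriv \<eta> Z X p
          + \<eta> p (Z p) * ext_deriv \<eta> X Y p \<noteq> 0) \<and>
     (\<forall>p. \<eta> p (\<xi> p) = 1) \<and>
     (\<forall>X p. vector_field A X \<longrightarrow> ext_deriv \<eta> \<xi> X p = 0)"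

definition contact_metric3 ::
    "('m, 3) chart set \<Rightarrow> ('m \<Rightarrow> 'm tangent \<Rightarrow> 'm tangent) \<Rightarrow> 'm vfield \<Rightarrow>
     ('m \<Rightarrow> 'm tangent \<Rightarrow> real) \<Rightarrow> 'm tensor2 \<Rightarrow> bool" where
  "contact_metric3 A \<phi> \<xi> \<eta> g \<longleftrightarrow>
     contact_form3 A \<eta> \<xi> \<and> endomorphism_field A \<phi> \<and> riemannian_metric A g \<and>
     (\<forall>p. \<forall>v \<in> tangent_space A p. \<phi> p (\<phi> p v) = tscale (\<eta> p v) (\<xi> p) - v) \<and>
     (\<forall>p. \<forall>v \<in> tangent_space A p. \<forall>w \<in> tangent_space A p.
        g p (\<phi> p v) (\<phi> p w) = g p v w - \<eta> p v * \<eta> p w) \<and>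
     (\<forall>X Y p. vector_field A X \<longrightarrow> vector_field A Y \<longrightarrow>
        ext_deriv \<eta> X Y p = g p (X p) (\<phi> p (Y p)))"

definition sasakian3 ::
    "('m, 3) chart set \<Rightarrow> ('m \<Rightarrow> 'm tangent \<Rightarrow> 'm tangent) \<Rightarrow> 'm vfield \<Rightarrow>
     ('m \<Rightarrow> 'm tangent \<Rightarrow> real) \<Rightarrow> 'm tensor2 \<Rightarrow> bool" where
  "sasakian3 A \<phi> \<xi> \<eta> g \<longleftrightarrow> contact_metric3 A \<phi> \<xi> \<eta> g \<and>
     (\<exists>nabla. levi_civita A g nabla \<and>
        (\<forall>X Y p. vector_field A X \<longrightarrow> vector_field A Y \<longrightarrow>
           curvature nabla X Y \<xi> p = tscale (\<eta> p (Y p)) (X p) - tscale (\<eta> p (X p)) (Y p)))"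

definition lorentzian_sasakian3 ::
    "('m, 3) chart set \<Rightarrow> ('m \<Rightarrow> 'm tangent \<Rightarrow> 'm tangent) \<Rightarrow> 'm vfield \<Rightarrow>
     ('m \<Rightarrow> 'm tangent \<Rightarrow> real) \<Rightarrow> 'm tensor2 \<Rightarrow> bool" where
  "lorentzian_sasakian3 A \<phi> \<xi> \<eta> g \<longleftrightarrow>
     (\<exists>g'. sasakian3 A \<phi> \<xi> \<eta> g' \<and> g = (\<lambda>p v w. g' p v w - 2 * \<eta> p v * \<eta> p w))"

text \<open>The \<open>\<phi>\<close>-sectional curvature is that of the Lorentzian metric \<open>g\<close>, whose Levi-Civita
  connection is \<open>nabla\<close>.\<close>

definition lorentzian_sasakian_space_form3 ::
    "('m::{t2_space, second_countable_topology}, 3) chart set \<Rightarrow>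
     ('m \<Rightarrow> 'm tangent \<Rightarrow> 'm tangent) \<Rightarrow> 'm vfield \<Rightarrow>
     ('m \<Rightarrow> 'm tangent \<Rightarrow> real) \<Rightarrow> 'm tensor2 \<Rightarrow> 'm connection \<Rightarrow> real \<Rightarrow> bool" where
  "lorentzian_sasakian_space_form3 A \<phi> \<xi> \<eta> g nabla H \<longleftrightarrow>
     smooth_atlas A \<and> simply_connected (UNIV :: 'm set) \<and>
     lorentzian_sasakian3 A \<phi> \<xi> \<eta> g \<and> levi_civita A g nabla \<and>
     (\<forall>X p. vector_field A X \<longrightarrow> X p \<noteq> 0 \<longrightarrow> g p (X p) (\<xi> p) = 0 \<longrightarrow>
        sectional_curvature g nabla X (\<lambda>q. \<phi> q (X q)) p = H)"


subsection \<open>Sasakian frames\<close>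

text \<open>The matrix \<open>h = diag(-1,1,1)\<close>. It is its own inverse, so \<open>h j\<close> both lowers and raises
  the index \<open>j\<close>.\<close>

definition h :: "3 \<Rightarrow> real" where
  "h j = (if j = 1 then -1 else 1)"

definition sasakian_frame ::
    "('m, 3) chart set \<Rightarrow> 'm vfield \<Rightarrow> 'm tensor2 \<Rightarrow> real \<Rightarrow> (3 \<Rightarrow> 'm vfield) \<Rightarrow> bool" where
  "sasakian_frame A \<xi> g H e \<longleftrightarrow>
     (\<forall>j. vector_field A (e j)) \<and>
     (\<forall>p. \<forall>v \<in> tangent_space A p. \<exists>!c :: real ^ 3. v = (\<Sum>j\<in>UNIV. tscale (c $ j) (e j p))) \<and>
     (\<forall>p i j. g p (e i p) (e j p) = (if i = j then h i else 0)) \<and>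
     e 1 = \<xi> \<and>
     lie_bracket (e 1) (e 2) = vscale (\<lambda>_. - ((H - 3) / 2)) (e 3) \<and>
     lie_bracket (e 1) (e 3) = vscale (\<lambda>_. (H - 3) / 2) (e 2) \<and>
     lie_bracket (e 2) (e 3) = vscale (\<lambda>_. - 2) (e 1)"

text \<open>Dual coframe \<open>\<omega>\<^sup>j\<close> of an orthonormal frame.\<close>

definition coframe :: "'m tensor2 \<Rightarrow> (3 \<Rightarrow> 'm vfield) \<Rightarrow> 3 \<Rightarrow> 'm \<Rightarrow> 'm tangent \<Rightarrow> real" where
  "coframe g e j p v = h j * g p v (e j p)"

definition metric_trace :: "(3 \<Rightarrow> 'm vfield) \<Rightarrow> 'm tensor2 \<Rightarrow> 'm \<Rightarrow> real" where
  "metric_trace e T p = (\<Sum>j\<in>UNIV. h j * T p (e j p) (e j p))"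

text \<open>\<open>Ric(X,Y) = tr (Z \<mapsto> R(Z,X)Y)\<close>\<close>

definition ricci ::
    "'m tensor2 \<Rightarrow> 'm connection \<Rightarrow> (3 \<Rightarrow> 'm vfield) \<Rightarrow> 'm vfield \<Rightarrow> 'm vfield \<Rightarrow> 'm \<Rightarrow> real" where
  "ricci g nabla e X Y p = (\<Sum>j\<in>UNIV. coframe g e j p (curvature nabla (e j) X Y p))"

definition scalar_curvature ::
    "'m tensor2 \<Rightarrow> 'm connection \<Rightarrow> (3 \<Rightarrow> 'm vfield) \<Rightarrow> 'm \<Rightarrow> real" where
  "scalar_curvature g nabla e p = (\<Sum>j\<in>UNIV. h j * ricci g nabla e (e j) (e j) p)"


subsection \<open>Spinors\<close>

text \<open>Spinor fields are \<open>\<complex>\<^sup>2\<close>-valued functions, their components being taken with respect to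
  the frame.\<close>

type_synonym 'm spinor_field = "'m \<Rightarrow> complex ^ 2"

definition pauli1 :: "complex ^ 2 ^ 2" where
  "pauli1 = vector [vector [0, 1], vector [1, 0]]"
definition pauli2 :: "complex ^ 2 ^ 2" where
  "pauli2 = vector [vector [0, - \<i>], vector [\<i>, 0]]"
definition pauli3 :: "complex ^ 2 ^ 2" where
  "pauli3 = vector [vector [1, 0], vector [0, - 1]]"

definition gam :: "3 \<Rightarrow> complex ^ 2 ^ 2" where
  "gam j = (if j = 1 then pauli1
            else if j = 2 then map_matrix ((*) \<i>) pauli2
            else map_matrix ((*) \<i>) pauli3)"

definition clifford ::
    "'m tensor2 \<Rightarrow> (3 \<Rightarrow> 'm vfield) \<Rightarrow> 'm \<Rightarrow> 'm tangent \<Rightarrow> complex ^ 2 \<Rightarrow> complex ^ 2" where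
  "clifford g e p v s = (\<Sum>j\<in>UNIV. complex_of_real (coframe g e j p v) *s (gam j *v s))"

definition spinor_prod :: "complex ^ 2 \<Rightarrow> complex ^ 2 \<Rightarrow> complex" where
  "spinor_prod s t = (\<Sum>k\<in>UNIV. cnj (s $ k) * (gam 1 *v t) $ k)"

definition smooth_spinor :: "('m, 3) chart set \<Rightarrow> 'm spinor_field \<Rightarrow> bool" where
  "smooth_spinor A \<psi> \<longleftrightarrow>
     (\<forall>k. smooth_fun A (\<lambda>p. Re (\<psi> p $ k)) \<and> smooth_fun A (\<lambda>p. Im (\<psi> p $ k)))"

definition deriv_spinor :: "'m tangent \<Rightarrow> 'm spinor_field \<Rightarrow> complex ^ 2" where
  "deriv_spinor v \<psi> = (\<chi> k. Complex (v (\<lambda>q. Re (\<psi> q $ k))) (v (\<lambda>q. Im (\<psi> q $ k))))"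

definition spin_form ::
    "'m tensor2 \<Rightarrow> (3 \<Rightarrow> 'm vfield) \<Rightarrow> real \<Rightarrow> 'm \<Rightarrow> 'm tangent \<Rightarrow> complex ^ 2 \<Rightarrow> complex ^ 2" where
  "spin_form g e H p v s =
     (- \<i> / 2) *s (\<Sum>j\<in>UNIV. complex_of_real (coframe g e j p v) *s (gam j *v s))
     + (\<i> * complex_of_real ((H + 1) / 4 * coframe g e 1 p v)) *s (gam 1 *v s)"

definition spin_deriv ::
    "'m tensor2 \<Rightarrow> (3 \<Rightarrow> 'm vfield) \<Rightarrow> real \<Rightarrow> 'm \<Rightarrow> 'm tangent \<Rightarrow> 'm spinor_field \<Rightarrow> complex ^ 2"
  where
  "spin_deriv g e H p v \<psi> = deriv_spinor v \<psi> + spin_form g e H p v (\<psi> p)"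

definition SqK_spinor ::
    "('m, 3) chart set \<Rightarrow> 'm vfield \<Rightarrow> ('m \<Rightarrow> 'm tangent \<Rightarrow> real) \<Rightarrow> 'm tensor2 \<Rightarrow>
     (3 \<Rightarrow> 'm vfield) \<Rightarrow> real \<Rightarrow> real \<Rightarrow> real \<Rightarrow> 'm spinor_field \<Rightarrow> bool" where
  "SqK_spinor A \<xi> \<eta> g e H a b \<psi> \<longleftrightarrow> smooth_spinor A \<psi> \<and>
     (\<forall>p. \<forall>v \<in> tangent_space A p.
        spin_deriv g e H p v \<psi> =
          (\<i> * complex_of_real a) *s clifford g e p v (\<psi> p)
          + (\<i> * complex_of_real (b * \<eta> p v)) *s clifford g e p (\<xi> p) (\<psi> p))"

definition dirac ::
    "'m tensor2 \<Rightarrow> (3 \<Rightarrow> 'm vfield) \<Rightarrow> real \<Rightarrow> 'm spinor_field \<Rightarrow> 'm spinor_field" where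
  "dirac g e H \<psi> p =
     \<i> *s (\<Sum>j\<in>UNIV. complex_of_real (h j) *s (gam j *v spin_deriv g e H p (e j p) \<psi>))"

definition T_spin ::
    "'m tensor2 \<Rightarrow> (3 \<Rightarrow> 'm vfield) \<Rightarrow> real \<Rightarrow> 'm spinor_field \<Rightarrow> 'm tensor2" where
  "T_spin g e H \<psi> p v w = 1/4 * Re (spinor_prod (\<psi> p)
     (\<i> *s (clifford g e p v (spin_deriv g e H p w \<psi>)
            + clifford g e p w (spin_deriv g e H p v \<psi>))))"

definition ED_solution ::
    "('m, 3) chart set \<Rightarrow> 'm tensor2 \<Rightarrow> 'm connection \<Rightarrow> (3 \<Rightarrow> 'm vfield) \<Rightarrow> real \<Rightarrow>
     real \<Rightarrow> real \<Rightarrow> 'm spinor_field \<Rightarrow> bool" where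
  "ED_solution A g nabla e H lam \<Lambda> \<psi> \<longleftrightarrow>
     (\<forall>p. dirac g e H \<psi> p = complex_of_real lam *s \<psi> p) \<and>
     (\<forall>X Y p. vector_field A X \<longrightarrow> vector_field A Y \<longrightarrow>
        ricci g nabla e X Y p =
          T_spin g e H \<psi> p (X p) (Y p)
          - metric_trace e (T_spin g e H \<psi>) p * g p (X p) (Y p)
          + 2 * \<Lambda> * g p (X p) (Y p))"


subsection \<open>Energy conditions\<close>

definition null_vector :: "('m, 3) chart set \<Rightarrow> 'm tensor2 \<Rightarrow> 'm \<Rightarrow> 'm tangent \<Rightarrow> bool" where
  "null_vector A g p v \<longleftrightarrow> v \<in> tangent_space A p \<and> v \<noteq> 0 \<and> g p v v = 0"

definition timelike :: "('m, 3) chart set \<Rightarrow> 'm tensor2 \<Rightarrow> 'm \<Rightarrow> 'm tangent \<Rightarrow> bool" where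
  "timelike A g p v \<longleftrightarrow> v \<in> tangent_space A p \<and> g p v v < 0"

text \<open>Causal vectors are nonzero. With signature \<open>(-,+,+)\<close>, a causal vector lies in the same
  cone as the timelike field \<open>\<xi>\<close> iff its product with \<open>\<xi>\<close> is negative.\<close>

definition future_causal ::
    "('m, 3) chart set \<Rightarrow> 'm vfield \<Rightarrow> 'm tensor2 \<Rightarrow> 'm \<Rightarrow> 'm tangent \<Rightarrow> bool" where
  "future_causal A \<xi> g p v \<longleftrightarrow>
     v \<in> tangent_space A p \<and> v \<noteq> 0 \<and> g p v v \<le> 0 \<and> g p v (\<xi> p) < 0"

definition sharp ::
    "('m, 3) chart set \<Rightarrow> 'm tensor2 \<Rightarrow> 'm \<Rightarrow> ('m tangent \<Rightarrow> real) \<Rightarrow> 'm tangent" where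
  "sharp A g p \<alpha> =
     (THE v. v \<in> tangent_space A p \<and> (\<forall>w \<in> tangent_space A p. g p v w = \<alpha> w))"

definition NEC :: "('m, 3) chart set \<Rightarrow> 'm tensor2 \<Rightarrow> 'm tensor2 \<Rightarrow> bool" where
  "NEC A g T \<longleftrightarrow> (\<forall>p v. null_vector A g p v \<longrightarrow> T p v v \<ge> 0)"

definition WEC :: "('m, 3) chart set \<Rightarrow> 'm tensor2 \<Rightarrow> 'm tensor2 \<Rightarrow> bool" where
  "WEC A g T \<longleftrightarrow> (\<forall>p v. timelike A g p v \<longrightarrow> T p v v \<ge> 0)"

definition DEC :: "('m, 3) chart set \<Rightarrow> 'm vfield \<Rightarrow> 'm tensor2 \<Rightarrow> 'm tensor2 \<Rightarrow> bool" where
  "DEC A \<xi> g T \<longleftrightarrow>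
     (\<forall>p v. future_causal A \<xi> g p v \<longrightarrow> future_causal A \<xi> g p (- sharp A g p (T p v)))"

definition SEC ::
    "('m, 3) chart set \<Rightarrow> 'm tensor2 \<Rightarrow> (3 \<Rightarrow> 'm vfield) \<Rightarrow> 'm tensor2 \<Rightarrow> bool" where
  "SEC A g e T \<longleftrightarrow>
     (\<forall>p v. timelike A g p v \<longrightarrow> T p v v - metric_trace e T p * g p v v \<ge> 0)"

end

theory Submission
  imports Defs
begin

text \<open>
  The Clifford relations turn the quasi-Killing equation into
  \<open>T = \<kappa> g + \<mu> \<eta> \<otimes> \<eta>\<close> with \<open>\<kappa> = a N / 2\<close>, \<open>\<mu> = - b N / 2\<close>,
  \<open>N = \<langle>\<psi>,\<psi>\<rangle>\<close>. Koszul's formula in the Sasakian frame gives \<open>S = 2 H - 4\<close>, which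
  determines \<open>N\<close>. For a tensor of this shape the energy conditions are inequalities between
  \<open>\<kappa>\<close> and \<open>\<mu>\<close>; the extremal vectors are \<open>\<xi>\<close> and, by a limit, \<open>\<xi> + e\<^sub>2\<close>.
\<close>

section \<open>Derivations and constant functions\<close>

lemma tscale_simps [simp]: "tscale 1 v = v" "tscale 0 v = 0" "tscale c (tscale d v) = tscale (c * d) v"
  by (auto simp: tscale_def fun_eq_iff)

lemma tangent_space_combination:
  assumes "v \<in> tangent_space A p" "w \<in> tangent_space A p"
  shows "tscale a v + tscale b w \<in> tangent_space A p"
  using assms unfolding tangent_space_def tscale_def by (simp add: algebra_simps)

text \<open>Linearity gives \<open>c * v c\<close> and Leibniz gives \<open>2 * c * v c\<close> for
  the value of \<open>v\<close> on the constant \<open>c * c\<close>, so \<open>v\<close> kills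
  every nonzero constant; the zero function is covered by linearity alone.\<close>

lemma tangent_const:
  assumes "v \<in> tangent_space A p"
  shows "v (\<lambda>_. c) = 0"
proof (cases "smooth_fun A (\<lambda>_. c)")
  case True
  have lin: "v (\<lambda>q. x * c + y * c) = x * v (\<lambda>_. c) + y * v (\<lambda>_. c)" for x y
    using assms True unfolding tangent_space_def by blast
  have "v (\<lambda>q. c * c) = v (\<lambda>_. c) * c + c * v (\<lambda>_. c)"
    using assms True unfolding tangent_space_def by blast
  with lin[of c 0] have "c = 0 \<or> v (\<lambda>_. c) = 0" by auto
  with lin[of 0 0] show ?thesis by auto
next
  case False
  with assms show ?thesis unfolding tangent_space_def by blast
qed

lemma smooth_on_const: "smooth_on S (\<lambda>_. c)"
proof -
  have "Ck_on k S (\<lambda>_. c)" for k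
    by (induction k arbitrary: c) (auto simp: frechet_derivative_const)
  then show ?thesis by (simp add: smooth_on_def)
qed

lemma smooth_fun_const: "smooth_fun A (\<lambda>_. c)"
  by (auto simp: smooth_fun_def comp_def smooth_on_const)

section \<open>Coordinates in a Lorentzian orthonormal frame\<close>

definition frame_vec :: "(3 \<Rightarrow> 'm vfield) \<Rightarrow> 'm \<Rightarrow> real ^ 3 \<Rightarrow> 'm tangent" where
  "frame_vec e p c = (\<Sum>j\<in>UNIV. tscale (c $ j) (e j p))"

text \<open>The pointwise algebra that the energy conditions see. Uniqueness of coordinates comes
  back from orthonormality, because each coordinate is a metric product with a frame vector.\<close>

locale lorentzian_frame =
  fixes A :: "('m, 3) chart set" and g :: "'m tensor2" and e :: "3 \<Rightarrow> 'm vfield"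
  assumes frame_field: "vector_field A (e j)"
    and spans: "v \<in> tangent_space A p \<Longrightarrow> \<exists>c. v = frame_vec e p c"
    and orthonormal: "g p (e i p) (e j p) = (if i = j then h i else 0)"
    and sym: "\<lbrakk>v \<in> tangent_space A p; w \<in> tangent_space A p\<rbrakk> \<Longrightarrow> g p v w = g p w v"
    and linear: "\<lbrakk>u \<in> tangent_space A p; v \<in> tangent_space A p; w \<in> tangent_space A p\<rbrakk>
      \<Longrightarrow> g p (tscale x u + tscale y v) w = x * g p u w + y * g p v w"
begin

lemma frame_tangent: "e j p \<in> tangent_space A p"
  using frame_field by (simp add: vector_field_def)

text \<open>The extra \<open>tscale 1\<close> nests the sum as binary combinations, the only shape
  to which \<open>linear\<close> and \<open>tangent_space_combination\<close> apply.\<close>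

lemma frame_vec_split:
  "frame_vec e p c =
     tscale 1 (tscale (c $ 1) (e 1 p) + tscale (c $ 2) (e 2 p)) + tscale (c $ 3) (e 3 p)"
  by (simp add: frame_vec_def sum_3)

lemma frame_vec_tangent: "frame_vec e p c \<in> tangent_space A p"
  unfolding frame_vec_split by (intro tangent_space_combination frame_tangent)

lemma tangent_cases:
  assumes "v \<in> tangent_space A p"
  obtains c where "v = frame_vec e p c"
  using spans assms by blast

lemma metric_frame_vec_left:
  assumes "w \<in> tangent_space A p"
  shows "g p (frame_vec e p c) w =
    c $ 1 * g p (e 1 p) w + c $ 2 * g p (e 2 p) w + c $ 3 * g p (e 3 p) w"
  unfolding frame_vec_split
  using assms by (simp only: linear tangent_space_combination frame_tangent mult_1)

lemma metric_frame:
  "g p (frame_vec e p c) (e j p) = h j * c $ j"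
  "g p (e j p) (frame_vec e p c) = h j * c $ j"
proof -
  show "g p (frame_vec e p c) (e j p) = h j * c $ j"
    by (subst metric_frame_vec_left[OF frame_tangent], cases j rule: exhaust_3[THEN disjE])
      (auto simp: orthonormal)
  then show "g p (e j p) (frame_vec e p c) = h j * c $ j"
    using sym frame_vec_tangent frame_tangent by metis
qed

lemma metric_frame_vec:
  "g p (frame_vec e p c) (frame_vec e p d) = - c $ 1 * d $ 1 + c $ 2 * d $ 2 + c $ 3 * d $ 3"
  by (subst metric_frame_vec_left[OF frame_vec_tangent]) (simp add: metric_frame h_def)

lemma coframe_frame_vec: "coframe g e j p (frame_vec e p c) = c $ j"
  by (simp add: coframe_def metric_frame h_def)

lemma frame_vec_inject: "frame_vec e p c = frame_vec e p d \<longleftrightarrow> c = d"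
  by (metis coframe_frame_vec vec_eq_iff)

lemma frame_vec_zero: "frame_vec e p c = 0 \<longleftrightarrow> c = 0"
  using frame_vec_inject[of p c 0] by (simp add: frame_vec_def sum_3 )

lemma frame_eq_frame_vec: "e j p = frame_vec e p (axis j 1)"
  using exhaust_3[of j] by (auto simp: frame_vec_def sum_3 axis_def)

text \<open>Nondegeneracy of \<open>g\<close>. It gives the uniqueness behind \<open>sharp\<close>
  and later identifies covariant derivatives from their frame components.\<close>

lemma tangent_eqI:
  assumes "v \<in> tangent_space A p" "w \<in> tangent_space A p"
    and "\<And>j. g p v (e j p) = g p w (e j p)"
  shows "v = w"
proof -
  obtain c d where cd: "v = frame_vec e p c" "w = frame_vec e p d"
    using assms tangent_cases by metis
  have "c $ j = d $ j" for j
    using assms(3)[of j] unfolding cd metric_frame by (auto simp: h_def split: if_splits)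
  then have "c = d" by (simp add: vec_eq_iff)
  then show ?thesis by (simp add: cd)
qed

lemma sharp_eqI:
  assumes "v \<in> tangent_space A p" "\<And>w. w \<in> tangent_space A p \<Longrightarrow> g p v w = \<alpha> w"
  shows "sharp A g p \<alpha> = v"
  unfolding sharp_def
proof (rule the_equality)
  show "v \<in> tangent_space A p \<and> (\<forall>w\<in>tangent_space A p. g p v w = \<alpha> w)"
    using assms by blast
  show "u = v" if "u \<in> tangent_space A p \<and> (\<forall>w\<in>tangent_space A p. g p u w = \<alpha> w)" for u
    using that assms by (intro tangent_eqI) (auto simp: frame_tangent)
qed

end

section \<open>Energy conditions for tensors of perfect fluid shape\<close>

locale perfect_fluid = lorentzian_frame +
  fixes T :: "'a tensor2" and \<kappa> \<mu> :: real
  assumes fluid: "T p (frame_vec e p c) (frame_vec e p d) =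
    \<kappa> * g p (frame_vec e p c) (frame_vec e p d) + \<mu> * c $ 1 * d $ 1"
begin

lemma metric_trace_fluid: "metric_trace e T p = 3 * \<kappa> - \<mu>"
proof -
  have "T p (e j p) (e j p) = \<kappa> * h j + \<mu> * (axis j 1 $ 1)\<^sup>2" for j
    using fluid[of p "axis j 1" "axis j 1"]
    by (simp add: frame_eq_frame_vec[symmetric] orthonormal power2_eq_square)
  then show ?thesis
    by (simp add: metric_trace_def sum_3 h_def axis_def)
qed

lemma NEC_fluid: "NEC A g T \<longleftrightarrow> \<mu> \<ge> 0"
proof
  assume nec: "NEC A g T"
  \<comment> \<open>Testing at one arbitrary point is enough, since \<kappa> and \<mu> are
    constants. The vector is \<open>e 1 + e 2\<close>; being null, it leaves only the
    \<mu>-term.\<close>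
  let ?v = "frame_vec e undefined (vector [1, 1, 0])"
  have "null_vector A g undefined ?v"
    by (auto simp: null_vector_def frame_vec_tangent frame_vec_zero metric_frame_vec vec_eq_iff forall_3)
  then have "T undefined ?v ?v \<ge> 0"
    using nec by (simp add: NEC_def)
  then show "\<mu> \<ge> 0"
    by (simp add: fluid metric_frame_vec)
next
  assume "\<mu> \<ge> 0"
  show "NEC A g T"
    unfolding NEC_def
  proof (intro allI impI)
    fix p v
    assume v: "null_vector A g p v"
    then obtain c where "v = frame_vec e p c"
      unfolding null_vector_def using tangent_cases by blast
    with v \<open>\<mu> \<ge> 0\<close> show "0 \<le> T p v v"
      by (simp add: null_vector_def fluid mult.assoc)
  qed
qed

text \<open>Subtracting \<open>t * g\<close> only replaces \<kappa> by \<kappa> - t, so one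
  statement serves two conditions: t = 0 is WEC, and t = tr T = 3\<kappa> - \<mu> is SEC, where
  \<mu> \<ge> \<kappa> - t turns into \<kappa> \<ge> 0.\<close>

lemma timelike_fluid:
  "(\<forall>p v. timelike A g p v \<longrightarrow> T p v v - t * g p v v \<ge> 0) \<longleftrightarrow> \<mu> \<ge> 0 \<and> \<mu> \<ge> \<kappa> - t"
proof
  assume ec: "\<forall>p v. timelike A g p v \<longrightarrow> T p v v - t * g p v v \<ge> 0"
  have tl: "\<mu> - (\<kappa> - t) * (1 - x\<^sup>2) \<ge> 0" if "\<bar>x\<bar> < 1" for x
  proof -
    let ?v = "frame_vec e undefined (vector [1, x, 0])"
    have "x\<^sup>2 < 1" using that by (simp add: abs_square_less_1)
    then have "timelike A g undefined ?v"
      by (simp add: timelike_def frame_vec_tangent metric_frame_vec power2_eq_square)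
    then have "T undefined ?v ?v - t * g undefined ?v ?v \<ge> 0"
      using ec by blast
    then show ?thesis
      by (simp add: fluid metric_frame_vec power2_eq_square algebra_simps)
  qed
  \<comment> \<open>As x tends to 1 the timelike vectors \<open>e 1 + x e 2\<close> tend to a null
    one, which is not itself admissible; continuity still yields \<mu> \<ge> 0. The other inequality
    is x = 0, the vector \<open>e 1\<close>.\<close>
  have "((\<lambda>x. \<mu> - (\<kappa> - t) * (1 - x\<^sup>2)) \<longlongrightarrow> \<mu> - (\<kappa> - t) * (1 - 1\<^sup>2)) (at_left 1)"
    by (intro tendsto_intros)
  moreover have "eventually (\<lambda>x::real. \<mu> - (\<kappa> - t) * (1 - x\<^sup>2) \<ge> 0) (at_left 1)"
    by (rule eventually_mono[OF eventually_at_left_real[OF zero_less_one]]) (use tl in force)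
  ultimately have "\<mu> - (\<kappa> - t) * (1 - 1\<^sup>2) \<ge> 0"
    by (rule tendsto_lowerbound) simp
  then show "\<mu> \<ge> 0 \<and> \<mu> \<ge> \<kappa> - t"
    using tl[of 0] by simp
next
  assume \<mu>: "\<mu> \<ge> 0 \<and> \<mu> \<ge> \<kappa> - t"
  show "\<forall>p v. timelike A g p v \<longrightarrow> T p v v - t * g p v v \<ge> 0"
  proof (intro allI impI)
    fix p v
    assume v: "timelike A g p v"
    then obtain c where c: "v = frame_vec e p c"
      unfolding timelike_def using tangent_cases by blast
    \<comment> \<open>With m = -g(v,v) and (c $ 1)^2 = m + s, the value is a combination of the
      nonnegative numbers m and s whose coefficients are exactly the two assumed bounds.\<close>
    define s where "s = c $ 2 * c $ 2 + c $ 3 * c $ 3"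
    define m where "m = c $ 1 * c $ 1 - s"
    have "m > 0"
      using v by (simp add: timelike_def c metric_frame_vec m_def s_def)
    moreover have "s \<ge> 0" by (simp add: s_def)
    ultimately have "(\<mu> - (\<kappa> - t)) * m + \<mu> * s \<ge> 0"
      using \<mu> by simp
    also have "(\<mu> - (\<kappa> - t)) * m + \<mu> * s = T p v v - t * g p v v"
      by (simp add: c fluid metric_frame_vec m_def s_def algebra_simps)
    finally show "T p v v - t * g p v v \<ge> 0" .
  qed
qed

lemma WEC_fluid: "WEC A g T \<longleftrightarrow> \<mu> \<ge> 0 \<and> \<mu> \<ge> \<kappa>"
  using timelike_fluid[of 0] by (simp add: WEC_def)

lemma SEC_fluid: "SEC A g e T \<longleftrightarrow> \<mu> \<ge> 0 \<and> \<kappa> \<ge> 0"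
  using timelike_fluid[of "3 * \<kappa> - \<mu>"] by (auto simp: SEC_def metric_trace_fluid)

text \<open>As an endomorphism T is diagonal: \<kappa> on the complement of \<open>e 1\<close>, and
  \<kappa> - \<mu> on \<open>e 1\<close> because g(e 1, e 1) = -1. Thus \<mu> - \<kappa> is the
  energy density and \<kappa> the pressure.\<close>

lemma sharp_fluid:
  "- sharp A g p (T p (frame_vec e p c)) =
     frame_vec e p (vector [(\<mu> - \<kappa>) * c $ 1, - \<kappa> * c $ 2, - \<kappa> * c $ 3])"
proof -
  have "sharp A g p (T p (frame_vec e p c)) =
     frame_vec e p (vector [(\<kappa> - \<mu>) * c $ 1, \<kappa> * c $ 2, \<kappa> * c $ 3])"
  proof (rule sharp_eqI[OF frame_vec_tangent])
    fix w assume "w \<in> tangent_space A p"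
    then obtain d where "w = frame_vec e p d" by (rule tangent_cases)
    then show "g p (frame_vec e p (vector [(\<kappa> - \<mu>) * c $ 1, \<kappa> * c $ 2, \<kappa> * c $ 3])) w =
      T p (frame_vec e p c) w"
      by (simp add: fluid metric_frame_vec algebra_simps)
  qed
  then show ?thesis
    by (simp add: frame_vec_def sum_3 tscale_def fun_eq_iff algebra_simps)
qed

lemma future_causal_frame_vec:
  "future_causal A (e 1) g p (frame_vec e p c) \<longleftrightarrow>
     c $ 1 > 0 \<and> (c $ 2)\<^sup>2 + (c $ 3)\<^sup>2 \<le> (c $ 1)\<^sup>2"
  by (auto simp: future_causal_def frame_vec_tangent frame_vec_zero metric_frame_vec metric_frame
      h_def power2_eq_square)

text \<open>The flux stays in the future cone when the density is positive and dominates the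
  absolute pressure. The null vector \<open>e 1 + e 2\<close> is the extremal test; the first
  inequality is strict because future causal vectors have positive time component.\<close>

lemma DEC_fluid: "DEC A (e 1) g T \<longleftrightarrow> \<mu> > \<kappa> \<and> \<bar>\<kappa>\<bar> \<le> \<mu> - \<kappa>"
proof
  assume dec: "DEC A (e 1) g T"
  let ?v = "frame_vec e undefined (vector [1, 1, 0])"
  have "future_causal A (e 1) g undefined ?v"
    by (simp add: future_causal_frame_vec)
  with dec have "future_causal A (e 1) g undefined (- sharp A g undefined (T undefined ?v))"
    unfolding DEC_def by blast
  then have "\<mu> > \<kappa> \<and> \<kappa>\<^sup>2 \<le> (\<mu> - \<kappa>)\<^sup>2"
    by (simp add: sharp_fluid future_causal_frame_vec)
  then show "\<mu> > \<kappa> \<and> \<bar>\<kappa>\<bar> \<le> \<mu> - \<kappa>"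
    using abs_le_square_iff[of \<kappa> "\<mu> - \<kappa>"] by auto
next
  assume \<mu>: "\<mu> > \<kappa> \<and> \<bar>\<kappa>\<bar> \<le> \<mu> - \<kappa>"
  then have sq: "\<kappa>\<^sup>2 \<le> (\<mu> - \<kappa>)\<^sup>2"
    using abs_le_square_iff[of \<kappa> "\<mu> - \<kappa>"] by auto
  show "DEC A (e 1) g T"
    unfolding DEC_def
  proof (intro allI impI)
    fix p v
    assume v: "future_causal A (e 1) g p v"
    then obtain c where c: "v = frame_vec e p c"
      unfolding future_causal_def using tangent_cases by blast
    have 1: "c $ 1 > 0" "(c $ 2)\<^sup>2 + (c $ 3)\<^sup>2 \<le> (c $ 1)\<^sup>2"
      using v by (auto simp: c future_causal_frame_vec)
    have "\<kappa>\<^sup>2 * ((c $ 2)\<^sup>2 + (c $ 3)\<^sup>2) \<le> (\<mu> - \<kappa>)\<^sup>2 * (c $ 1)\<^sup>2"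
      using sq 1 by (intro mult_mono) auto
    with \<mu> 1 show "future_causal A (e 1) g p (- sharp A g p (T p v))"
      by (simp add: c sharp_fluid future_causal_frame_vec power_mult_distrib distrib_left)
  qed
qed

end

section \<open>Clifford multiplication and the spinor energy-momentum tensor\<close>

lemma gam_components:
  "(gam 1 *v s) $ 1 = s $ 2" "(gam 1 *v s) $ 2 = s $ 1"
  "(gam 2 *v s) $ 1 = s $ 2" "(gam 2 *v s) $ 2 = - s $ 1"
  "(gam 3 *v s) $ 1 = \<i> * s $ 1" "(gam 3 *v s) $ 2 = - \<i> * s $ 2"
  by (simp_all add: gam_def pauli1_def pauli2_def pauli3_def matrix_vector_mult_def
      map_matrix_def sum_2)

lemma (in lorentzian_frame) clifford_components:
  "clifford g e p (frame_vec e p c) s $ 1 =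
     (of_real (c $ 1) + of_real (c $ 2)) * s $ 2 + \<i> * of_real (c $ 3) * s $ 1"
  "clifford g e p (frame_vec e p c) s $ 2 =
     (of_real (c $ 1) - of_real (c $ 2)) * s $ 1 - \<i> * of_real (c $ 3) * s $ 2"
  by (simp_all add: clifford_def sum_3 gam_components coframe_frame_vec algebra_simps)

text \<open>The Clifford relation X Y + Y X = -2 g(X,Y) produces the a-term. For the b-term, Re
  \<langle>\<psi>, X \<xi> \<psi>\<rangle> = \<eta>(X) \<langle>\<psi>,\<psi>\<rangle>: the
  components of X along \<open>e 2\<close> and \<open>e 3\<close> contribute the anti-Hermitian
  matrices \<open>gam 1 ** gam j ** gam 1 = - gam j\<close>, whose expectation values are
  imaginary.\<close>

lemma (in lorentzian_frame) T_spin_SqK: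
  assumes "SqK_spinor A (e 1) \<eta> g e H a b \<psi>"
    and eta: "\<And>p c. \<eta> p (frame_vec e p c) = c $ 1"
  shows "T_spin g e H \<psi> p (frame_vec e p c) (frame_vec e p d) =
    (a * g p (frame_vec e p c) (frame_vec e p d) - b * c $ 1 * d $ 1)
      * Re (spinor_prod (\<psi> p) (\<psi> p)) / 2"
proof -
  have D: "spin_deriv g e H p (frame_vec e p c) \<psi> =
      (\<i> * of_real a) *s clifford g e p (frame_vec e p c) (\<psi> p)
      + (\<i> * of_real (b * c $ 1)) *s clifford g e p (frame_vec e p (axis 1 1)) (\<psi> p)" for c
    using assms(1)[unfolded SqK_spinor_def, THEN conjunct2, rule_format, OF frame_vec_tangent, of p c]
    by (simp only: eta frame_eq_frame_vec)
  show ?thesis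
    unfolding T_spin_def D spinor_prod_def sum_2 gam_components metric_frame_vec
    by (simp add: clifford_components axis_def) algebra
qed

section \<open>Levi-Civita connection in the frame and scalar curvature\<close>

lemma (in lorentzian_frame) metric_scaled_frame:
  "g p (tscale c (e k p)) (e l p) = (if l = k then c * h k else 0)"
  using linear[OF frame_tangent frame_tangent frame_tangent, of p c k 0 k l]
  by (auto simp: orthonormal)

lemma (in lorentzian_frame) metric_zero: "g p 0 (e l p) = 0"
  using metric_scaled_frame[of p 0 l l] by simp

lemma lie_bracket_swap: "lie_bracket Y X = - lie_bracket X Y"
  by (simp add: lie_bracket_def fun_eq_iff)

lemma vscale_const_apply: "vscale (\<lambda>_. c) X p = tscale c (X p)"
  by (simp add: vscale_def)

lemma affine_connection_vscale:
  assumes "affine_connection A nabla" "vector_field A X" "vector_field A Y"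
  shows "nabla (vscale (\<lambda>_. c) X) Y = vscale (\<lambda>_. c) (nabla X Y)"
    and "nabla X (vscale (\<lambda>_. c) Y) = vscale (\<lambda>_. c) (nabla X Y)"
proof -
  show "nabla (vscale (\<lambda>_. c) X) Y = vscale (\<lambda>_. c) (nabla X Y)"
    using assms(1)[unfolded affine_connection_def, THEN conjunct2, THEN conjunct2, rule_format,
        OF assms(2,3) smooth_fun_const] by (rule conjunct1)
  have "nabla X (vscale (\<lambda>_. c) Y) = vscale (\<lambda>p. X p (\<lambda>_. c)) Y + vscale (\<lambda>_. c) (nabla X Y)"
    using assms(1)[unfolded affine_connection_def, THEN conjunct2, THEN conjunct2, rule_format,
        OF assms(2,3) smooth_fun_const] by (rule conjunct2)
  moreover have "X p (\<lambda>_. c) = 0" for p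
    using assms(2) by (intro tangent_const[of "X p" A p]) (simp add: vector_field_def)
  ultimately show "nabla X (vscale (\<lambda>_. c) Y) = vscale (\<lambda>_. c) (nabla X Y)"
    by (simp add: vscale_def tscale_def fun_eq_iff)
qed

lemma levi_civitaD:
  assumes "levi_civita A g nabla"
  shows "affine_connection A nabla"
    and "\<lbrakk>vector_field A X; vector_field A Y\<rbrakk> \<Longrightarrow> vector_field A (nabla X Y)"
    and "\<lbrakk>vector_field A X; vector_field A Y\<rbrakk> \<Longrightarrow> nabla X Y - nabla Y X = lie_bracket X Y"
    and "\<lbrakk>vector_field A X; vector_field A Y; vector_field A Z\<rbrakk> \<Longrightarrow>
      X p (\<lambda>q. g q (Y q) (Z q)) = g p (nabla X Y p) (Z p) + g p (Y p) (nabla X Z p)"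
  using assms by (simp_all add: levi_civita_def affine_connection_def)

text \<open>The products g(e i, e j) are constant, so Koszul's formula keeps only its three bracket
  terms. The form of \<open>coeff\<close> fits the Sasakian frame, where each covariant derivative
  is a multiple of a single frame field.\<close>

lemma (in lorentzian_frame) koszul:
  assumes lc: "levi_civita A g nabla"
  defines "B \<equiv> \<lambda>p i j l. g p (lie_bracket (e i) (e j) p) (e l p)"
  assumes coeff: "\<forall>p l. B p i j l - B p j l i + B p l i j = (if l = k then 2 * c * h k else 0)"
    and bracket: "\<And>i j p. lie_bracket (e i) (e j) p \<in> tangent_space A p"
  shows "nabla (e i) (e j) = vscale (\<lambda>_. c) (e k)"
proof
  fix p
  define G where "G i j k = g p (nabla (e i) (e j) p) (e k p)" for i j k
  have nt: "nabla (e i) (e j) p \<in> tangent_space A p" for i j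
    using levi_civitaD(2)[OF lc frame_field frame_field] by (simp add: vector_field_def)
  have torsion: "G i j l = G j i l + B p i j l" for i j l
  proof -
    have "nabla (e i) (e j) - nabla (e j) (e i) = lie_bracket (e i) (e j)"
      by (intro levi_civitaD(3)[OF lc] frame_field)
    then have "nabla (e i) (e j) p = nabla (e j) (e i) p + lie_bracket (e i) (e j) p"
      by (auto simp: fun_eq_iff algebra_simps)
    then have "nabla (e i) (e j) p = tscale 1 (nabla (e j) (e i) p) + tscale 1 (lie_bracket (e i) (e j) p)"
      by simp
    then show ?thesis
      unfolding G_def B_def
      using linear[OF nt bracket frame_tangent, of 1 j i 1 i j l] by simp
  qed
  have skew: "G i j l = - G i l j" for i j l
  proof -
    have "e i p (\<lambda>q. g q (e j q) (e l q)) =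
        g p (nabla (e i) (e j) p) (e l p) + g p (e j p) (nabla (e i) (e l) p)"
      by (intro levi_civitaD(4)[OF lc] frame_field)
    then show ?thesis
      by (simp add: orthonormal tangent_const[OF frame_tangent] G_def sym[OF frame_tangent nt])
  qed
  \<comment> \<open>Torsion-freeness for the three cyclic orders of i, j, l, combined with three
    uses of metric compatibility, adds up to Koszul's formula.\<close>
  have G2: "2 * G i j l = (if l = k then 2 * c * h k else 0)" for l
    using coeff[rule_format, of p l] torsion[of i j l] torsion[of j l i] torsion[of l i j]
      skew[of i j l] skew[of j i l] skew[of l i j] by linarith
  have "G i j l = g p (tscale c (e k p)) (e l p)" for l
    using G2[of l] by (simp add: metric_scaled_frame split: if_splits)
  moreover have "tscale c (e k p) \<in> tangent_space A p"
    using tangent_space_combination[OF frame_tangent frame_tangent, of c k p 0 k] by simp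
  ultimately show "nabla (e i) (e j) p = vscale (\<lambda>_. c) (e k) p"
    unfolding vscale_const_apply using nt[of i j] by (auto simp: G_def intro!: tangent_eqI)
qed

text \<open>The trace needs only R(e j, e i) e i, a multiple of \<open>e j\<close>. It gives Ric(e
  1, e 1) = 2 and Ric(e 2, e 2) = Ric(e 3, e 3) = H - 1, hence S = -2 + 2 (H - 1).\<close>

lemma (in lorentzian_frame) scalar_curvature_space_form:
  assumes lc: "levi_civita A g nabla"
    and br: "lie_bracket (e 1) (e 2) = vscale (\<lambda>_. - ((H - 3) / 2)) (e 3)"
      "lie_bracket (e 1) (e 3) = vscale (\<lambda>_. (H - 3) / 2) (e 2)"
      "lie_bracket (e 2) (e 3) = vscale (\<lambda>_. - 2) (e 1)"
  shows "scalar_curvature g nabla e p = 2 * H - 4"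
proof -
  have br': "lie_bracket (e 2) (e 1) = vscale (\<lambda>_. (H - 3) / 2) (e 3)"
    "lie_bracket (e 3) (e 1) = vscale (\<lambda>_. - ((H - 3) / 2)) (e 2)"
    "lie_bracket (e 3) (e 2) = vscale (\<lambda>_. 2) (e 1)"
    "lie_bracket (e j) (e j) = vscale (\<lambda>_. 0) (e j)" for j
    unfolding lie_bracket_swap[of "e 2" "e 1"] lie_bracket_swap[of "e 3" "e 1"]
      lie_bracket_swap[of "e 3" "e 2"] br
    by (simp_all add: lie_bracket_def vscale_def tscale_def fun_eq_iff)
  have ts: "tscale c (e k p) \<in> tangent_space A p" for c k p
    using tangent_space_combination[OF frame_tangent frame_tangent, of c k p 0 k] by simp
  have bt: "lie_bracket (e i) (e j) p \<in> tangent_space A p" for i j p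
    using exhaust_3[of i] exhaust_3[of j] ts[of 0]
    by (auto simp: br br' vscale_const_apply ts)
  note K = koszul[OF lc _ bt]
  note B = vscale_const_apply metric_scaled_frame br br' h_def
  \<comment> \<open>Vanishing derivatives are written as zero multiples of a frame field, so that
    the scaling rules \<open>sc\<close> also evaluate the second derivatives in the
    curvature.\<close>
  have nabla: "nabla (e 1) (e 1) = vscale (\<lambda>_. 0) (e 1)"
    "nabla (e 1) (e 2) = vscale (\<lambda>_. (1 - H) / 2) (e 3)"
    "nabla (e 1) (e 3) = vscale (\<lambda>_. - ((1 - H) / 2)) (e 2)"
    "nabla (e 2) (e 1) = vscale (\<lambda>_. -1) (e 3)"
    "nabla (e 2) (e 2) = vscale (\<lambda>_. 0) (e 1)"
    "nabla (e 2) (e 3) = vscale (\<lambda>_. -1) (e 1)"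
    "nabla (e 3) (e 1) = vscale (\<lambda>_. 1) (e 2)"
    "nabla (e 3) (e 2) = vscale (\<lambda>_. 1) (e 1)"
    "nabla (e 3) (e 3) = vscale (\<lambda>_. 0) (e 1)"
    by (rule K, simp add: forall_3 B metric_zero field_simps)+
  have ac: "affine_connection A nabla"
    by (rule levi_civitaD(1)[OF lc])
  note sc = affine_connection_vscale[OF ac frame_field frame_field]
  have curv: "curvature nabla (e j) (e i) (e i) p =
      tscale (if i = j then 0 else if i = 1 then 1 else if j = 1 then -1 else H) (e j p)" for i j
    using exhaust_3[of i] exhaust_3[of j]
    by (auto simp: curvature_def nabla sc br br') (simp_all add: vscale_def tscale_def fun_eq_iff field_simps)
  show ?thesis
    unfolding scalar_curvature_def ricci_def coframe_def curv
    by (simp add: sum_3 metric_scaled_frame h_def)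
qed

section \<open>From the Sasakian structure to the frame\<close>

text \<open>The Reeb condition d\<eta>(\<xi>, \<phi> X) = 0 reads g(\<xi>, \<phi>(\<phi> X)) = 0,
  and \<phi>(\<phi> X) = \<eta>(X) \<xi> - X. This is what links \<eta> to the metric.\<close>

lemma sasakian3_metric_reeb:
  assumes "sasakian3 A \<phi> \<xi> \<eta> g" "vector_field A X"
  shows "g p (X p) (\<xi> p) = \<eta> p (X p) * g p (\<xi> p) (\<xi> p)"
proof -
  have cm: "contact_form3 A \<eta> \<xi>" "endomorphism_field A \<phi>" "symmetric_tensor A g"
    and phi2: "\<And>v p. v \<in> tangent_space A p \<Longrightarrow> \<phi> p (\<phi> p v) = tscale (\<eta> p v) (\<xi> p) - v"
    and d\<eta>: "\<And>X Y p. vector_field A X \<Longrightarrow> vector_field A Y \<Longrightarrow>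
        ext_deriv \<eta> X Y p = g p (X p) (\<phi> p (Y p))"
    using assms(1) unfolding sasakian3_def contact_metric3_def riemannian_metric_def by blast+
  have \<xi>: "vector_field A \<xi>" and reeb: "\<And>Y. vector_field A Y \<Longrightarrow> ext_deriv \<eta> \<xi> Y p = 0"
    using cm(1) unfolding contact_form3_def by blast+
  have t: "X p \<in> tangent_space A p" "\<xi> p \<in> tangent_space A p"
    using \<xi> assms(2) by (auto simp: vector_field_def)
  have Y: "vector_field A (\<lambda>q. \<phi> q (X q))"
    using cm(2) assms(2) unfolding endomorphism_field_def by blast
  have eq: "\<phi> p (\<phi> p (X p)) = tscale (\<eta> p (X p)) (\<xi> p) + tscale (-1) (X p)"
    unfolding phi2[OF t(1)] by (simp add: tscale_def fun_eq_iff)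
  have tp: "tscale (\<eta> p (X p)) (\<xi> p) + tscale (-1) (X p) \<in> tangent_space A p"
    using t by (intro tangent_space_combination)
  have "0 = g p (\<xi> p) (tscale (\<eta> p (X p)) (\<xi> p) + tscale (-1) (X p))"
    using reeb[OF Y] d\<eta>[OF \<xi> Y] eq by simp
  also have "\<dots> = g p (tscale (\<eta> p (X p)) (\<xi> p) + tscale (-1) (X p)) (\<xi> p)"
    using cm(3) t tp unfolding symmetric_tensor_def by blast
  also have "\<dots> = \<eta> p (X p) * g p (\<xi> p) (\<xi> p) + (-1) * g p (X p) (\<xi> p)"
    using cm(3) t unfolding symmetric_tensor_def by blast
  finally show ?thesis by simp
qed

lemma lorentzian_sasakian3_frame:
  assumes "lorentzian_sasakian3 A \<phi> \<xi> \<eta> g" "sasakian_frame A \<xi> g H e"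
  shows "lorentzian_frame A g e" and "\<eta> p (frame_vec e p c) = c $ 1"
proof -
  obtain g' where g': "sasakian3 A \<phi> \<xi> \<eta> g'" and g: "g = (\<lambda>p v w. g' p v w - 2 * \<eta> p v * \<eta> p w)"
    using assms(1) unfolding lorentzian_sasakian3_def by blast
  have st: "symmetric_tensor A g'" and of: "one_form A \<eta>" and \<eta>\<xi>: "\<And>p. \<eta> p (\<xi> p) = 1"
    using g'
    by (simp_all add: sasakian3_def contact_metric3_def contact_form3_def riemannian_metric_def)
  have \<eta>: "\<eta> p (tscale a v + tscale b w) = a * \<eta> p v + b * \<eta> p w"
    if "v \<in> tangent_space A p" "w \<in> tangent_space A p" for p v w a b
    using of that unfolding one_form_def by blast
  have fr: "\<And>j. vector_field A (e j)" "\<xi> = e 1"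
    "\<And>p i j. g p (e i p) (e j p) = (if i = j then h i else 0)"
    "\<And>p v. v \<in> tangent_space A p \<Longrightarrow> \<exists>c :: real ^ 3. v = (\<Sum>j\<in>UNIV. tscale (c $ j) (e j p))"
    using assms(2) unfolding sasakian_frame_def by (simp, simp, blast, metis)
  show lf: "lorentzian_frame A g e"
  proof
    show "vector_field A (e j)" for j by (fact fr)
    show "\<exists>c. v = frame_vec e p c" if "v \<in> tangent_space A p" for p v
      using fr(4)[OF that] by (simp add: frame_vec_def)
    show "g p (e i p) (e j p) = (if i = j then h i else 0)" for p i j by (fact fr)
    show "g p v w = g p w v" if "v \<in> tangent_space A p" "w \<in> tangent_space A p" for p v w
      using st that unfolding g symmetric_tensor_def by simp
    show "g p (tscale x u + tscale y v) w = x * g p u w + y * g p v w"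
      if "u \<in> tangent_space A p" "v \<in> tangent_space A p" "w \<in> tangent_space A p" for p u v w x y
      using st that \<eta>[OF that(1,2)] unfolding g symmetric_tensor_def
      by (simp add: algebra_simps)
  qed
  interpret lorentzian_frame A g e by (fact lf)
  \<comment> \<open>Passing to \<open>g\<close> subtracts 2 at \<xi>, so g(\<xi>,\<xi>) = -1 means
    g'(\<xi>,\<xi>) = 1. For j other than 1, orthogonality then reads 0 = \<eta>(e j) - 2 \<eta>(e
    j), so \<eta> is the first coordinate.\<close>
  have "g' p (e 1 p) (e 1 p) = 1"
    using fr(3)[of p 1 1] \<eta>\<xi>[of p] unfolding g fr(2) by (simp add: h_def)
  then have "\<eta> p (e j p) = (if j = 1 then 1 else 0)" for j
    using sasakian3_metric_reeb[OF g' frame_field, of p j] fr(3)[of p j 1] \<eta>\<xi>[of p]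
    unfolding g fr(2) by (auto simp: h_def)
  then show "\<eta> p (frame_vec e p c) = c $ 1"
    unfolding frame_vec_split by (simp only: \<eta> tangent_space_combination frame_tangent) simp
qed

section \<open>Energy conditions for the three solution types\<close>

theorem proposition4p7:
  fixes A :: "('m::{t2_space, second_countable_topology}, 3) chart set"
    and \<phi> :: "'m \<Rightarrow> 'm tangent \<Rightarrow> 'm tangent"
    and \<xi> :: "'m vfield"
    and \<eta> :: "'m \<Rightarrow> 'm tangent \<Rightarrow> real"
    and g :: "'m tensor2"
    and nabla :: "'m connection"
    and e :: "3 \<Rightarrow> 'm vfield"
    and \<psi> :: "'m spinor_field"
    and H a b lam \<Lambda> :: real
  assumes "lorentzian_sasakian_space_form3 A \<phi> \<xi> \<eta> g nabla H"
    and "sasakian_frame A \<xi> g H e"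
    and "SqK_spinor A \<xi> \<eta> g e H a b \<psi>"
    and "ED_solution A g nabla e H lam \<Lambda> \<psi>"
    and "lam \<noteq> 0"
    and "\<And>p. scalar_curvature g nabla e p - 6 * \<Lambda> \<noteq> 0"
    and "\<And>p. spinor_prod (\<psi> p) (\<psi> p) =
           complex_of_real (- (scalar_curvature g nabla e p - 6 * \<Lambda>) / lam)"
  shows
    "(a = - 1/2 \<and> b = (H + 1) / 4 \<and> lam = (H - 5) / 4 \<and> \<Lambda> = 1 \<longrightarrow>
        (NEC A g (T_spin g e H \<psi>) \<longleftrightarrow> - 1 \<le> H) \<and>
        (WEC A g (T_spin g e H \<psi>) \<longleftrightarrow> 1 \<le> H) \<and>
        (DEC A \<xi> g (T_spin g e H \<psi>) \<longleftrightarrow> 3 \<le> H) \<and>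
        (SEC A g e (T_spin g e H \<psi>) \<longleftrightarrow> - 1 \<le> H)) \<and>
     (H < 3 \<and> a = (- 1 + sqrt (3 - H)) / 2 \<and> b = (2 - sqrt (3 - H)) / 2 \<and>
        lam = sqrt (3 - H) - 1/2 \<and> \<Lambda> = - sqrt (3 - H) + H - 2 \<longrightarrow>
        (NEC A g (T_spin g e H \<psi>) \<longleftrightarrow> - 1 \<le> H) \<and>
        (WEC A g (T_spin g e H \<psi>) \<longleftrightarrow> - 1 \<le> H \<and> H < 3) \<and>
        (DEC A \<xi> g (T_spin g e H \<psi>) \<longleftrightarrow> - 1 \<le> H \<and> H < 3) \<and>
        (SEC A g e (T_spin g e H \<psi>) \<longleftrightarrow> 2 \<le> H \<and> H < 3)) \<and>
     (H < 3 \<and> a = (- 1 - sqrt (3 - H)) / 2 \<and> b = (2 + sqrt (3 - H)) / 2 \<and>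
        lam = - sqrt (3 - H) - 1/2 \<and> \<Lambda> = sqrt (3 - H) + H - 2 \<longrightarrow>
        (NEC A g (T_spin g e H \<psi>) \<longleftrightarrow> - 1 \<le> H) \<and>
        (WEC A g (T_spin g e H \<psi>) \<longleftrightarrow> - 1 \<le> H \<and> H < 3) \<and>
        \<not> DEC A \<xi> g (T_spin g e H \<psi>) \<and>
        (SEC A g e (T_spin g e H \<psi>) \<longleftrightarrow> - 1 \<le> H \<and> H < 3))"
proof -
  have \<xi>: "\<xi> = e 1"
    and br: "lie_bracket (e 1) (e 2) = vscale (\<lambda>_. - ((H - 3) / 2)) (e 3)"
      "lie_bracket (e 1) (e 3) = vscale (\<lambda>_. (H - 3) / 2) (e 2)"
      "lie_bracket (e 2) (e 3) = vscale (\<lambda>_. - 2) (e 1)"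
    using assms(2) unfolding sasakian_frame_def by (elim conjE; simp only:)+
  have ls: "lorentzian_sasakian3 A \<phi> \<xi> \<eta> g" and lc: "levi_civita A g nabla"
    using assms(1) by (simp_all add: lorentzian_sasakian_space_form3_def)
  interpret lorentzian_frame A g e
    by (rule lorentzian_sasakian3_frame(1)[OF ls assms(2)])
  note \<eta> = lorentzian_sasakian3_frame(2)[OF ls assms(2)]
  note S = scalar_curvature_space_form[OF lc br]
  define N where "N = - (2 * H - 4 - 6 * \<Lambda>) / lam"
  have "Re (spinor_prod (\<psi> p) (\<psi> p)) = N" for p
    using assms(7)[of p] unfolding S N_def by (metis Re_complex_of_real)
  note T = T_spin_SqK[OF assms(3)[unfolded \<xi>] \<eta>, unfolded this]
  interpret perfect_fluid A g e "T_spin g e H \<psi>" "a * N / 2" "- b * N / 2"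
    by unfold_locales (simp add: T field_simps)
  note conditions = NEC_fluid WEC_fluid DEC_fluid[folded \<xi>] SEC_fluid
  have nz: "2 * H - 4 - 6 * \<Lambda> \<noteq> 0"
    using assms(6) S by metis
  show ?thesis
    unfolding conditions
  proof (intro conjI[of "_ \<longrightarrow> _"] impI)
    assume i: "a = - 1/2 \<and> b = (H + 1) / 4 \<and> lam = (H - 5) / 4 \<and> \<Lambda> = 1"
    \<comment> \<open>Here S - 6 \<Lambda> = 2 H - 10 = 8 lam, so \<kappa> = 2 and \<mu> = H +
      1.\<close>
    then have "N = - 8"
      using assms(5) by (simp add: N_def field_simps)
    then show "(0 \<le> - b * N / 2 \<longleftrightarrow> - 1 \<le> H) \<and>
        (0 \<le> - b * N / 2 \<and> a * N / 2 \<le> - b * N / 2 \<longleftrightarrow> 1 \<le> H) \<and>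
        (a * N / 2 < - b * N / 2 \<and> \<bar>a * N / 2\<bar> \<le> - b * N / 2 - a * N / 2 \<longleftrightarrow> 3 \<le> H) \<and>
        (0 \<le> - b * N / 2 \<and> 0 \<le> a * N / 2 \<longleftrightarrow> - 1 \<le> H)"
      using i by auto
  next
    assume ii: "H < 3 \<and> a = (- 1 + sqrt (3 - H)) / 2 \<and> b = (2 - sqrt (3 - H)) / 2 \<and>
        lam = sqrt (3 - H) - 1/2 \<and> \<Lambda> = - sqrt (3 - H) + H - 2"
    \<comment> \<open>In terms of s all data are polynomial, and the thresholds H = -1 and H = 2
      become s = 2 and s = 1.\<close>
    define s where "s = sqrt (3 - H)"
    have s: "s > 0" "H = 3 - s\<^sup>2"
      using ii by (auto simp: s_def)
    have L: "a = (- 1 + s) / 2" "b = (2 - s) / 2" "lam = s - 1/2" "\<Lambda> = 1 - s - s\<^sup>2"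
      using ii s(2) unfolding s_def[symmetric] by linarith+
    \<comment> \<open>The factor \<open>lam\<close> splits off and cancels, which makes N polynomial
      in s.\<close>
    have "2 * H - 4 - 6 * \<Lambda> = lam * (4 * (s + 2))"
      unfolding L s(2) by (simp add: algebra_simps power2_eq_square)
    then have N: "N = - 4 * (s + 2)"
      using assms(5) by (simp add: N_def)
    have \<mu>: "- b * N / 2 = (2 - s) * (s + 2)" and \<kappa>: "a * N / 2 = (1 - s) * (s + 2)"
      unfolding L N by (simp_all add: field_simps)
    have diff: "- b * N / 2 - a * N / 2 = s + 2"
      unfolding \<mu> \<kappa> by (simp add: algebra_simps)
    have "- 1 \<le> H \<longleftrightarrow> s \<le> 2" "2 \<le> H \<longleftrightarrow> s \<le> 1"
      using s(1) power2_le_iff_abs_le[of 2 s] power2_le_iff_abs_le[of 1 s] by (auto simp: s(2))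
    moreover have "0 \<le> - b * N / 2 \<longleftrightarrow> s \<le> 2" "0 \<le> a * N / 2 \<longleftrightarrow> s \<le> 1"
      using s(1) unfolding \<mu> \<kappa> by (simp_all add: zero_le_mult_iff)
    \<comment> \<open>Dividing by the positive density s + 2 leaves |1 - s| \<le> 1, and s > 0 holds
      already.\<close>
    moreover have "\<bar>a * N / 2\<bar> \<le> - b * N / 2 - a * N / 2 \<longleftrightarrow> s \<le> 2"
      unfolding diff unfolding \<kappa> using s(1) by (auto simp: abs_mult mult_le_cancel_right2)
    moreover have "a * N / 2 < - b * N / 2"
      using s(1) diff by linarith
    ultimately show "(0 \<le> - b * N / 2 \<longleftrightarrow> - 1 \<le> H) \<and>
        (0 \<le> - b * N / 2 \<and> a * N / 2 \<le> - b * N / 2 \<longleftrightarrow> - 1 \<le> H \<and> H < 3) \<and>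
        (a * N / 2 < - b * N / 2 \<and> \<bar>a * N / 2\<bar> \<le> - b * N / 2 - a * N / 2 \<longleftrightarrow>
          - 1 \<le> H \<and> H < 3) \<and>
        (0 \<le> - b * N / 2 \<and> 0 \<le> a * N / 2 \<longleftrightarrow> 2 \<le> H \<and> H < 3)"
      using ii by linarith
  next
    assume iii: "H < 3 \<and> a = (- 1 - sqrt (3 - H)) / 2 \<and> b = (2 + sqrt (3 - H)) / 2 \<and>
        lam = - sqrt (3 - H) - 1/2 \<and> \<Lambda> = sqrt (3 - H) + H - 2"
    define s where "s = sqrt (3 - H)"
    have s: "s > 0" "H = 3 - s\<^sup>2"
      using iii by (auto simp: s_def)
    have L: "a = (- 1 - s) / 2" "b = (2 + s) / 2" "lam = - s - 1/2" "\<Lambda> = 1 + s - s\<^sup>2"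
      using iii s(2) unfolding s_def[symmetric] by linarith+
    have num: "2 * H - 4 - 6 * \<Lambda> = lam * (4 * (2 - s))"
      unfolding L s(2) by (simp add: algebra_simps power2_eq_square)
    then have N: "N = - 4 * (2 - s)"
      using assms(5) by (simp add: N_def)
    have \<mu>: "- b * N / 2 = (2 + s) * (2 - s)" and \<kappa>: "a * N / 2 = (1 + s) * (2 - s)"
      unfolding L N by (simp_all add: field_simps)
    have diff: "- b * N / 2 - a * N / 2 = 2 - s"
      unfolding \<mu> \<kappa> by (simp add: algebra_simps)
    \<comment> \<open>At \<open>s = 2\<close>, i.e. \<open>H = - 1\<close>, the spinor would be null; this value is excluded
      by \<open>S - 6 \<Lambda> \<noteq> 0\<close>, so the boundary case of the equivalences does not occur.\<close>
    have "s \<noteq> 2"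
      using nz num by auto
    have "- 1 \<le> H \<longleftrightarrow> s \<le> 2"
      using s(1) power2_le_iff_abs_le[of 2 s] by (auto simp: s(2))
    moreover have "0 \<le> - b * N / 2 \<longleftrightarrow> s \<le> 2" "0 \<le> a * N / 2 \<longleftrightarrow> s \<le> 2"
      using s(1) unfolding \<mu> \<kappa> by (auto simp: zero_le_mult_iff)
    \<comment> \<open>The pressure always wins: its absolute value is (1 + s) |2 - s|, strictly
      larger than |2 - s| and hence than the density 2 - s.\<close>
    moreover have "\<not> \<bar>a * N / 2\<bar> \<le> - b * N / 2 - a * N / 2"
    proof -
      have "\<bar>(1 + s) * (2 - s)\<bar> = \<bar>2 - s\<bar> + s * \<bar>2 - s\<bar>"
        unfolding abs_mult using s(1) by (simp add: distrib_right)
      moreover have "s * \<bar>2 - s\<bar> > 0"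
        using s(1) \<open>s \<noteq> 2\<close> by simp
      ultimately show ?thesis
        unfolding diff unfolding \<kappa> by linarith
    qed
    ultimately show "(0 \<le> - b * N / 2 \<longleftrightarrow> - 1 \<le> H) \<and>
        (0 \<le> - b * N / 2 \<and> a * N / 2 \<le> - b * N / 2 \<longleftrightarrow> - 1 \<le> H \<and> H < 3) \<and>
        \<not> (a * N / 2 < - b * N / 2 \<and> \<bar>a * N / 2\<bar> \<le> - b * N / 2 - a * N / 2) \<and>
        (0 \<le> - b * N / 2 \<and> 0 \<le> a * N / 2 \<longleftrightarrow> - 1 \<le> H \<and> H < 3)"
      using iii diff by linarith
  qed
qed

end
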